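(* Let $X=\bigsqcup_n X_n$ be a space of graphs. If $X$ is an expander, or if $X$ has large girth and all vertices (of all the graphs $X_n$) have degree at least three, then $X$ does not have property $ULA$.
   Context: A metric space $X$ has bounded geometry if for all $R>0$ there is $N_R\in\mathbb{N}$ such that every closed ball of radius $R$ in $X$ has at most $N_R$ points. For $E\subseteq X$ and $R>0$: $N_R(E)=\{y\in X: d(y,E)\le R\}$ and $\partial_RE=N_R(E)\setminus E$. A space of graphs is a bounded geometry metric space $X$ for which there is a sequence $(X_n)_{n\in\mathbb{N}}$ of finite connected graphs (identified with their vertex sets) with $X=\bigsqcup_nX_n$ as a set, such that the metric on $X$ restricts to the edge (shortest path) metric on each $X_n$, and $d(X_n,X\setminus X_n)\to\infty$ as $n\to\infty$. By bounded geometry the vertex degrees are uniformly bounded. A space of graphs $X$ is an expander if $|X_n|\to\infty$ as $n\to\infty$ and there exists $\epsilon>0$ such that whenever $A\subseteq X_n$ satisfies $|A|\le|X_n|/2$ we have $|\partial_1A|\ge\epsilon|A|$. A space of graphs $X$ has large girth if $\mathrm{girth}(X_n)\to\infty$ as $n\to\infty$, where the girth of a finite graph is the length of its shortest non-trivial cycle. $ULA$: for all $R,\epsilon>0$ there exists $S>0$ such that for all finite nonempty subsets $F$ of $X$ there exists a finite set $E\subseteq X$ with $\mathrm{diam}(E)\le S$ and $|\partial_RE\cap F|<\epsilon|E\cap F|$. *)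

theory Defs
  imports "HOL-Analysis.Analysis" "Graph_Theory.Graph_Theory"
begin

text \<open>
  A metric space is a subset \<open>X\<close> of a type of class \<open>metric_space\<close>, with the induced metric
  (the subset may be the whole type).
\<close>

definition bounded_geometry :: "'a::metric_space set \<Rightarrow> bool" where
  "bounded_geometry X \<longleftrightarrow>
     (\<forall>R::real. R > 0 \<longrightarrow>
        (\<exists>N::nat. \<forall>x\<in>X. finite (cball x R \<inter> X) \<and> card (cball x R \<inter> X) \<le> N))"

text \<open>
  The library sets \<open>infdist y {} = 0\<close>, whereas the distance to the empty set should be
  infinite; hence the condition \<open>E \<noteq> {}\<close>.
\<close>

definition nbhd :: "'a::metric_space set \<Rightarrow> real \<Rightarrow> 'a set \<Rightarrow> 'a set" where
  "nbhd X R E = {y \<in> X. E \<noteq> {} \<and> infdist y E \<le> R}"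

definition bdry :: "'a::metric_space set \<Rightarrow> real \<Rightarrow> 'a set \<Rightarrow> 'a set" where
  "bdry X R E = nbhd X R E - E"

definition ULA :: "'a::metric_space set \<Rightarrow> bool" where
  "ULA X \<longleftrightarrow>
     (\<forall>R \<epsilon> :: real. R > 0 \<longrightarrow> \<epsilon> > 0 \<longrightarrow>
        (\<exists>S::real. S > 0 \<and>
           (\<forall>F. F \<subseteq> X \<longrightarrow> finite F \<longrightarrow> F \<noteq> {} \<longrightarrow>
              (\<exists>E. E \<subseteq> X \<and> finite E \<and> diameter E \<le> S \<and>
                   real (card (bdry X R E \<inter> F)) < \<epsilon> * real (card (E \<inter> F))))))"

text \<open>
  Graphs are finite, simple and undirected: in a \<open>pair_graph\<close> every edge is represented by its
  two opposite arcs, so the degree of a vertex is its out-degree. The cost \<open>\<mu>\<close> with unit weights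
  is the edge metric. As \<open>connected\<close> entails a nonempty vertex set and the vertex sets are
  disjoint, neither argument of \<open>setdist\<close> is empty (where the library value would be 0).
\<close>

definition space_of_graphs ::
    "'a::metric_space set \<Rightarrow> (nat \<Rightarrow> 'a pair_pre_digraph) \<Rightarrow> bool" where
  "space_of_graphs X G \<longleftrightarrow>
     bounded_geometry X \<and>
     (\<forall>n. pair_graph (G n) \<and> Digraph_Component.connected (with_proj (G n))) \<and>
     X = (\<Union>n. pverts (G n)) \<and>
     disjoint_family (\<lambda>n. pverts (G n)) \<and>
     (\<forall>n. \<forall>u\<in>pverts (G n). \<forall>v\<in>pverts (G n).
        ereal (dist u v) = wf_digraph.\<mu> (with_proj (G n)) (\<lambda>_. 1) u v) \<and>
     filterlim (\<lambda>n. setdist (pverts (G n)) (X - pverts (G n))) at_top sequentially"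

definition expander :: "'a::metric_space set \<Rightarrow> (nat \<Rightarrow> 'a pair_pre_digraph) \<Rightarrow> bool" where
  "expander X G \<longleftrightarrow>
     filterlim (\<lambda>n. card (pverts (G n))) at_top sequentially \<and>
     (\<exists>\<epsilon>::real. \<epsilon> > 0 \<and>
        (\<forall>n A. A \<subseteq> pverts (G n) \<longrightarrow> real (card A) \<le> real (card (pverts (G n))) / 2 \<longrightarrow>
           real (card (bdry X 1 A)) \<ge> \<epsilon> * real (card A)))"

text \<open>
  The library's \<open>cycle\<close> admits the closed walk running along an edge and back. Requiring length
  at least 3 excludes exactly these trivial cycles. The girth of a forest is infinite.
\<close>

definition girth :: "'a pair_pre_digraph \<Rightarrow> enat" where
  "girth G = (INF c \<in> {c. pre_digraph.cycle (with_proj G) c \<and> length c \<ge> 3}. enat (length c))"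

definition large_girth :: "(nat \<Rightarrow> 'a pair_pre_digraph) \<Rightarrow> bool" where
  "large_girth G \<longleftrightarrow> (\<lambda>n. girth (G n)) \<longlonglongrightarrow> \<infinity>"

end

theory Submission
  imports Defs
begin

text \<open>
  Applied to \<open>F = X\<^sub>n\<close>, property \<open>ULA\<close> yields subsets \<open>A\<close> of \<open>X\<^sub>n\<close> of uniformly bounded cardinality
  with relatively small \<open>1\<close>-boundary. For large \<open>n\<close> such \<open>A\<close> has at most half of the vertices, which
  contradicts expansion. If instead the girth of \<open>X\<^sub>n\<close> exceeds the cardinality of
  \<open>W = A \<union> \<partial>\<^sub>1A\<close>, then \<open>W\<close> spans a forest and so contains at most \<open>2\<bar>W\<bar>\<close> arcs; minimum
  degree three puts at least \<open>3\<bar>A\<bar>\<close> arcs into \<open>W\<close>, whence \<open>\<bar>A\<bar> \<le> 2\<bar>\<partial>\<^sub>1A\<bar>\<close>.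
\<close>

section \<open>Cycles in graphs of minimum degree two\<close>

lemma pcas_vwalk_arcs: "pcas u (vwalk_arcs (u # l)) (last (u # l))"
  by (induction l arbitrary: u) auto

lemma pawalk_verts_vwalk_arcs: "pawalk_verts u (vwalk_arcs (u # l)) = u # l"
  by (induction l arbitrary: u) auto

lemma length_vwalk_arcs: "length (vwalk_arcs p) = length p - 1"
  by (metis vwalk_length_def vwalk_length_simp)

text \<open>Cycles can thus be built from vertex lists. \<open>cycle\<close> asks for distinctness
  of the tail \<open>l @ [u]\<close>, which is a rotation of \<open>u # l\<close>.\<close>

lemma cycle_vwalk_arcs:
  assumes "set (vwalk_arcs (u # l @ [u])) \<subseteq> parcs G" "u \<in> pverts G"
    and "distinct (u # l)"
  shows "pre_digraph.cycle (with_proj G) (vwalk_arcs (u # l @ [u]))"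
proof -
  have "pcas u (vwalk_arcs (u # l @ [u])) u"
    using pcas_vwalk_arcs[of u "l @ [u]"] by simp
  moreover have "vwalk_arcs (u # l @ [u]) \<noteq> []"
    by (cases l) auto
  moreover have "distinct (tl (pawalk_verts u (vwalk_arcs (u # l @ [u]))))"
    unfolding pawalk_verts_vwalk_arcs using assms(3) by auto
  ultimately show ?thesis
    unfolding pre_digraph.cycle_def pre_digraph.awalk_def
    using assms(1,2) by (auto simp: cas_with_proj_eq awalk_verts_with_proj_eq)
qed

text \<open>On a longest path inside \<open>W\<close>, every neighbour in \<open>W\<close> of the
  first vertex lies on the path. One of them is not the second vertex, and the path up to it closes
  to a cycle. Staying inside \<open>W\<close> gives the length bound.\<close>

lemma ex_cycle_if_min_degree_two:
  assumes G: "pair_graph G" and W: "W \<subseteq> pverts G" "W \<noteq> {}"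
    and deg: "\<And>v. v \<in> W \<Longrightarrow> 2 \<le> card {w \<in> W. (v, w) \<in> parcs G}"
  obtains c where "pre_digraph.cycle (with_proj G) c" "3 \<le> length c" "length c \<le> card W"
proof -
  interpret pair_graph G by fact
  have fin: "finite W"
    using W(1) pair_finite_verts finite_subset by blast
  define P where "P p \<longleftrightarrow> p \<noteq> [] \<and> distinct p \<and> set p \<subseteq> W \<and> set (vwalk_arcs p) \<subseteq> parcs G" for p
  obtain v where "v \<in> W" using W(2) by blast
  then have "P [v]" by (simp add: P_def)
  moreover have bound: "length p \<le> card W" if "P p" for p
    using that fin by (metis P_def card_mono distinct_card)
  ultimately obtain p where p: "P p" and max: "\<And>q. P q \<Longrightarrow> length q \<le> length p"
    using ex_has_greatest_nat[of P "[v]" length "Suc (card W)"] by (metis less_Suc_eq_le)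
  then obtain x q where xq: "p = x # q"
    unfolding P_def by (cases p) auto
  have x: "x \<in> W" using p xq by (auto simp: P_def)
  \<comment> \<open>Otherwise \<open>y\<close> could be prepended to the path, against
    maximality.\<close>
  have nbrs: "y \<in> set q" if y: "y \<in> W" "(x, y) \<in> parcs G" for y
  proof (rule ccontr)
    assume "y \<notin> set q"
    moreover have "y \<noteq> x" using y(2) no_loops by fastforce
    moreover have "(y, x) \<in> parcs G" using y(2) arcs_symmetric by simp
    ultimately have "P (y # p)" using p y(1) xq by (auto simp: P_def)
    then show False using max by fastforce
  qed
  \<comment> \<open>\<open>hd q\<close> is the successor of \<open>x\<close> on the path. For empty
    \<open>q\<close> it is an unspecified vertex; the count still holds, and \<open>nbrs\<close>
    then excludes that case.\<close>
  have "\<not> {w \<in> W. (x, w) \<in> parcs G} \<subseteq> {hd q}"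
  proof
    assume "{w \<in> W. (x, w) \<in> parcs G} \<subseteq> {hd q}"
    then have "card {w \<in> W. (x, w) \<in> parcs G} \<le> card {hd q}"
      by (intro card_mono) auto
    then show False using deg[OF x] by simp
  qed
  then obtain y where y: "y \<in> W" "(x, y) \<in> parcs G" "y \<noteq> hd q" by blast
  then obtain as bs where q: "q = as @ y # bs"
    using nbrs by (meson split_list)
  \<comment> \<open>A vertex strictly between \<open>x\<close> and \<open>y\<close> keeps the closed
    walk from merely running along an edge and back: its length is \<open>length as + 2\<close>,
    hence at least 3.\<close>
  have "as \<noteq> []" using y(3) q by auto
  have "set (vwalk_arcs (x # as @ [y])) \<subseteq> set (vwalk_arcs p)"
    using set_vwalk_arcs_append1[of "x # as @ [y]" bs] xq q by simp
  then have "set (vwalk_arcs ((x # as @ [y]) @ [x])) \<subseteq> parcs G"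
    using p y(2) arcs_symmetric[of x y] set_vwalk_arcs_snoc[of "x # as @ [y]" x]
    by (auto simp: P_def)
  moreover have "distinct (x # as @ [y])"
    using p xq q by (auto simp: P_def)
  ultimately have "pre_digraph.cycle (with_proj G) (vwalk_arcs (x # (as @ [y]) @ [x]))"
    using x W(1) by (intro cycle_vwalk_arcs) auto
  moreover have "3 \<le> length (vwalk_arcs (x # (as @ [y]) @ [x]))"
    using \<open>as \<noteq> []\<close> unfolding length_vwalk_arcs by (cases as) auto
  moreover have "length (vwalk_arcs (x # (as @ [y]) @ [x])) \<le> card W"
    using bound[OF p] xq q unfolding length_vwalk_arcs by simp
  ultimately show thesis by (rule that)
qed

text \<open>By the previous lemma, a nonempty \<open>W\<close> smaller than the girth has a vertex
  with at most one neighbour in \<open>W\<close>. Deleting it costs at most one edge, that is two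
  arcs, and the smaller set still lies below the girth.\<close>

lemma card_arcs_le_if_girth_gt:
  assumes G: "pair_graph G" and "W \<subseteq> pverts G" "enat (card W) < girth G"
  shows "card (parcs G \<inter> W \<times> W) \<le> 2 * card W"
proof -
  interpret pair_graph G by fact
  have "finite W" using assms(2) pair_finite_verts finite_subset by blast
  then show ?thesis using assms(2,3)
  proof (induction W rule: finite_psubset_induct)
    case (psubset W)
    show ?case
    proof (cases "W = {}")
      case False
      have "\<exists>v\<in>W. card {w \<in> W. (v, w) \<in> parcs G} < 2"
      proof (rule ccontr)
        assume "\<not> ?thesis"
        then obtain c where c: "pre_digraph.cycle (with_proj G) c" "3 \<le> length c"
            "length c \<le> card W"
          using ex_cycle_if_min_degree_two[OF G psubset.prems(1) False] not_le_imp_less by blast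
        then have "girth G \<le> enat (length c)"
          unfolding girth_def by (intro INF_lower) auto
        with c(3) psubset.prems(2) show False
          by (metis enat_ord_simps(1) leD order_trans)
      qed
      then obtain v where v: "v \<in> W" "card {w \<in> W. (v, w) \<in> parcs G} < 2" by blast
      define N where "N = {w \<in> W. (v, w) \<in> parcs G}"
      define V where "V = W - {v}"
      have finN: "finite N" using psubset.hyps by (simp add: N_def)
      have cV: "card W = Suc (card V)"
        unfolding V_def by (rule card.remove[OF psubset.hyps v(1)])
      then have "enat (card V) < girth G"
        using psubset.prems(2) order.strict_trans[of "enat (card V)" "enat (card W)" "girth G"]
        by simp
      then have IH: "card (parcs G \<inter> V \<times> V) \<le> 2 * card V"
        using psubset.IH[of V] psubset.prems(1) v(1) unfolding V_def by blast
      \<comment> \<open>By symmetry the arcs into \<open>v\<close> are indexed by the same set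
        \<open>N\<close> as the arcs out of \<open>v\<close>.\<close>
      have "parcs G \<inter> W \<times> W
          \<subseteq> (parcs G \<inter> V \<times> V) \<union> (Pair v ` N \<union> (\<lambda>w. (w, v)) ` N)"
        using arcs_symmetric by (auto simp: V_def N_def)
      then have "card (parcs G \<inter> W \<times> W)
          \<le> card ((parcs G \<inter> V \<times> V) \<union> (Pair v ` N \<union> (\<lambda>w. (w, v)) ` N))"
        using finN pair_finite_arcs by (intro card_mono) auto
      also have "\<dots> \<le> card (parcs G \<inter> V \<times> V) + (card (Pair v ` N) + card ((\<lambda>w. (w, v)) ` N))"
        by (meson card_Un_le add_left_mono order_trans)
      also have "\<dots> \<le> 2 * card V + (card N + card N)"
        by (intro add_mono IH card_image_le finN)
      finally show ?thesis using v(2) cV by (simp add: N_def)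
    qed simp
  qed
qed

text \<open>The arcs leaving \<open>A\<close> are counted twice: there are at least three per vertex
  of \<open>A\<close>, and since all of them end in \<open>W\<close>, at most 2(|A| + |W - A|) in
  total.\<close>

lemma card_le_two_boundary_if_girth_gt:
  assumes G: "pair_graph G" and W: "W \<subseteq> pverts G" "A \<subseteq> W"
    and nbrs: "\<And>u v. u \<in> A \<Longrightarrow> (u, v) \<in> parcs G \<Longrightarrow> v \<in> W"
    and deg: "\<And>v. v \<in> A \<Longrightarrow> 3 \<le> out_degree (with_proj G) v"
    and girth: "enat (card W) < girth G"
  shows "card A \<le> 2 * card (W - A)"
proof -
  interpret pair_graph G by fact
  have fin: "finite W"
    using W(1) pair_finite_verts by (rule finite_subset)
  then have finA: "finite A"
    using W(2) by (rule rev_finite_subset)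
  have "card A * 3 = (\<Sum>v\<in>A. 3)" by simp
  also have "\<dots> \<le> (\<Sum>v\<in>A. card (out_arcs (with_proj G) v))"
    using deg by (intro sum_mono) (simp add: out_degree_def)
  also have "\<dots> = card (\<Union>v\<in>A. out_arcs (with_proj G) v)"
    using finA by (intro card_UN_disjoint[symmetric]) auto
  also have "\<dots> \<le> card (parcs G \<inter> W \<times> W)"
    using nbrs W(2) pair_finite_arcs by (intro card_mono) auto
  also have "\<dots> \<le> 2 * card W"
    using card_arcs_le_if_girth_gt[OF G W(1) girth] .
  also have "card W = card A + card (W - A)"
    using card_Diff_subset[OF finA W(2)] card_mono[OF fin W(2)] by simp
  finally show ?thesis by simp
qed

section \<open>Spaces of graphs\<close>

text \<open>A single arc is a walk of cost 1, and the metric is the infimum of the walk costs. This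
  places the graph neighbours of a set in its 1-neighbourhood.\<close>

lemma dist_le_one_if_arc:
  assumes "space_of_graphs X G" "(u, v) \<in> parcs (G n)"
  shows "dist u v \<le> 1"
proof -
  interpret pair_graph "G n"
    using assms(1) by (simp add: space_of_graphs_def)
  have uv: "u \<in> pverts (G n)" "v \<in> pverts (G n)"
    using assms(2) by (auto dest: wellformed)
  have "awalk u [(u, v)] v"
    using assms(2) uv by (auto simp: awalk_simps)
  then have "\<mu> (\<lambda>_. 1) u v \<le> ereal 1"
    using min_cost_le_walk_cost[of u "[(u, v)]" v "\<lambda>_. 1"] by simp
  moreover have "ereal (dist u v) = \<mu> (\<lambda>_. 1) u v"
    using assms(1) uv by (simp add: space_of_graphs_def)
  ultimately show ?thesis by (metis ereal_less_eq(3))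
qed

text \<open>Over a finite set the infimum is a minimum, so a point of \<open>nbhd X R A\<close> has
  an actual point of \<open>A\<close> within distance \<open>R\<close>.\<close>

lemma infdist_attained_finite:
  assumes "finite A" "A \<noteq> {}"
  obtains a where "a \<in> A" "infdist y A = dist y a"
proof -
  have "infdist y A = Min (dist y ` A)"
    using assms by (simp add: infdist_notempty cInf_eq_Min)
  then have "infdist y A \<in> dist y ` A"
    using assms Min_in[of "dist y ` A"] by simp
  then show thesis using that by blast
qed

text \<open>\<open>N\<close> is uniform in \<open>n\<close> because the 1-neighbourhood of a set of
  diameter at most \<open>S\<close> lies in a ball of radius \<open>S + 1\<close>. The whole
  neighbourhood is bounded, not only \<open>A\<close>, so that it can be compared with the
  girth.\<close>

lemma ULA_bounded_sets:
  assumes X: "space_of_graphs X G" and "ULA X" "0 < \<epsilon>"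
  obtains N where "\<And>n. \<exists>A. A \<subseteq> pverts (G n) \<and> A \<noteq> {} \<and>
    finite (nbhd X 1 A) \<and> card (nbhd X 1 A) \<le> N \<and>
    real (card (bdry X 1 A \<inter> pverts (G n))) < \<epsilon> * real (card A)"
proof -
  obtain S where S: "0 < S" and E: "\<And>F. F \<subseteq> X \<Longrightarrow> finite F \<Longrightarrow> F \<noteq> {} \<Longrightarrow>
      \<exists>E. E \<subseteq> X \<and> finite E \<and> diameter E \<le> S \<and>
        real (card (bdry X 1 E \<inter> F)) < \<epsilon> * real (card (E \<inter> F))"
    using assms(2)[unfolded ULA_def, rule_format, OF zero_less_one assms(3)] by blast
  have "0 < S + 1" using S by simp
  then obtain N where N:
      "\<And>x. x \<in> X \<Longrightarrow> finite (cball x (S + 1) \<inter> X) \<and> card (cball x (S + 1) \<inter> X) \<le> N"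
    using X[unfolded space_of_graphs_def bounded_geometry_def, THEN conjunct1] by blast
  show thesis
  proof (rule that)
    fix n
    interpret pair_graph "G n"
      using X by (simp add: space_of_graphs_def)
    let ?F = "pverts (G n)"
    have F: "?F \<subseteq> X" "?F \<noteq> {}"
      using X by (auto simp: space_of_graphs_def Digraph_Component.connected_def strongly_connected_def)
    obtain E where E: "E \<subseteq> X" "finite E" "diameter E \<le> S"
        "real (card (bdry X 1 E \<inter> ?F)) < \<epsilon> * real (card (E \<inter> ?F))"
      using E[OF F(1) pair_finite_verts F(2)] by blast
    define A where "A = E \<inter> ?F"
    \<comment> \<open>The inequality in \<open>ULA\<close> is strict, so its right-hand side cannot
      vanish.\<close>
    have "A \<noteq> {}" using E(4) by (auto simp: A_def)
    then obtain x where x: "x \<in> A" by blast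
    have finA: "finite A" using E(2) by (simp add: A_def)
    have "nbhd X 1 A \<subseteq> cball x (S + 1) \<inter> X"
    proof
      fix y assume y: "y \<in> nbhd X 1 A"
      obtain a where a: "a \<in> A" "infdist y A = dist y a"
        using infdist_attained_finite[OF finA \<open>A \<noteq> {}\<close>] .
      have "dist x a \<le> S"
        using diameter_bounded_bound[OF finite_imp_bounded[OF E(2)], of x a] a(1) x E(3)
        by (simp add: A_def)
      moreover have "dist y a \<le> 1" using y a(2) by (simp add: nbhd_def)
      ultimately have "dist x y \<le> S + 1"
        using dist_triangle2[of x y a] by linarith
      then show "y \<in> cball x (S + 1) \<inter> X" using y by (simp add: nbhd_def)
    qed
    moreover have "x \<in> X" using x E(1) by (auto simp: A_def)
    ultimately have "finite (nbhd X 1 A)" "card (nbhd X 1 A) \<le> N"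
      using N[of x] by (meson finite_subset card_mono order_trans)+
    \<comment> \<open>Cutting \<open>E\<close> down to the graph creates no boundary points there:
      inside \<open>?F\<close>, lying outside \<open>A\<close> means lying outside \<open>E\<close>,
      and distances to the smaller set only grow.\<close>
    moreover have "bdry X 1 A \<inter> ?F \<subseteq> bdry X 1 E \<inter> ?F"
    proof -
      have "infdist y E \<le> infdist y A" for y
        using infdist_mono[of A E y] \<open>A \<noteq> {}\<close> by (auto simp: A_def)
      then show ?thesis
        using \<open>A \<noteq> {}\<close> order_trans by (fastforce simp: bdry_def nbhd_def A_def)
    qed
    then have "card (bdry X 1 A \<inter> ?F) \<le> card (bdry X 1 E \<inter> ?F)"
      using pair_finite_verts by (intro card_mono) auto
    ultimately show "\<exists>A. A \<subseteq> ?F \<and> A \<noteq> {} \<and> finite (nbhd X 1 A) \<and> card (nbhd X 1 A) \<le> N \<and>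
        real (card (bdry X 1 A \<inter> ?F)) < \<epsilon> * real (card A)"
      using E(4) \<open>A \<noteq> {}\<close> by (intro exI[of _ A]) (auto simp: A_def)
  qed
qed

section \<open>Failure of \<open>ULA\<close> for expanders and for large girth\<close>

lemma subset_nbhd: "A \<subseteq> X \<Longrightarrow> 0 \<le> R \<Longrightarrow> A \<subseteq> nbhd X R A"
  by (auto simp: nbhd_def)

lemma expander_not_ULA:
  assumes X: "space_of_graphs X G" and "expander X G"
  shows "\<not> ULA X"
proof
  assume "ULA X"
  obtain \<epsilon> :: real where \<epsilon>: "0 < \<epsilon>" and expand: "\<And>n A. A \<subseteq> pverts (G n) \<Longrightarrow>
      real (card A) \<le> real (card (pverts (G n))) / 2 \<Longrightarrow>
      \<epsilon> * real (card A) \<le> real (card (bdry X 1 A))"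
    using assms(2) unfolding expander_def by blast
  obtain N where N: "\<And>n. \<exists>A. A \<subseteq> pverts (G n) \<and> A \<noteq> {} \<and>
      finite (nbhd X 1 A) \<and> card (nbhd X 1 A) \<le> N \<and>
      real (card (bdry X 1 A \<inter> pverts (G n))) < \<epsilon> * real (card A)"
    using ULA_bounded_sets[OF X \<open>ULA X\<close> \<epsilon>] by blast
  \<comment> \<open>The factor 2 makes any set of at most \<open>N\<close> vertices at most half of
    the graph.\<close>
  have "\<forall>\<^sub>F n in sequentially. 2 * N \<le> card (pverts (G n))"
    using assms(2) unfolding expander_def filterlim_at_top by blast
  \<comment> \<open>Expansion concerns the boundary in all of \<open>X\<close>, whereas the bound
    from \<open>ULA\<close> concerns its part in the graph. The two agree once the graph is more
    than 1 away from the rest of \<open>X\<close>.\<close>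
  moreover have "\<forall>\<^sub>F n in sequentially. 1 < setdist (pverts (G n)) (X - pverts (G n))"
    using X unfolding space_of_graphs_def filterlim_at_top_dense by blast
  ultimately have "\<forall>\<^sub>F n in sequentially. 2 * N \<le> card (pverts (G n)) \<and>
      1 < setdist (pverts (G n)) (X - pverts (G n))"
    by (rule eventually_conj)
  then obtain n where n: "2 * N \<le> card (pverts (G n))"
      "1 < setdist (pverts (G n)) (X - pverts (G n))"
    using eventually_happens'[OF sequentially_bot] by blast
  obtain A where A: "A \<subseteq> pverts (G n)" "A \<noteq> {}" "finite (nbhd X 1 A)" "card (nbhd X 1 A) \<le> N"
      "real (card (bdry X 1 A \<inter> pverts (G n))) < \<epsilon> * real (card A)"
    using N[of n] by blast
  have "pverts (G n) \<subseteq> X" using X by (auto simp: space_of_graphs_def)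
  then have "A \<subseteq> nbhd X 1 A" using A(1) by (intro subset_nbhd) auto
  then have "card A \<le> N" "finite A"
    using A(3,4) by (meson card_mono finite_subset order_trans)+
  have "bdry X 1 A \<subseteq> pverts (G n)"
  proof
    fix y assume y: "y \<in> bdry X 1 A"
    obtain a where a: "a \<in> A" "infdist y A = dist y a"
      using infdist_attained_finite[OF \<open>finite A\<close> A(2)] .
    have "dist a y \<le> 1" "y \<in> X"
      using y a(2) by (auto simp: bdry_def nbhd_def dist_commute)
    then show "y \<in> pverts (G n)"
      using setdist_le_dist[of a "pverts (G n)" y "X - pverts (G n)"] n(2) a(1) A(1) by fastforce
  qed
  then have "bdry X 1 A \<inter> pverts (G n) = bdry X 1 A" by blast
  moreover have "real (card A) \<le> real (card (pverts (G n))) / 2"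
    using \<open>card A \<le> N\<close> n(1) by linarith
  ultimately show False using expand[of A n] A(1,5) by simp
qed

lemma large_girth_not_ULA:
  assumes X: "space_of_graphs X G" and "large_girth G"
    and deg: "\<And>n v. v \<in> pverts (G n) \<Longrightarrow> 3 \<le> out_degree (with_proj (G n)) v"
  shows "\<not> ULA X"
proof
  assume "ULA X"
  \<comment> \<open>The value \<open>1/2\<close> is chosen to contradict |A| \<le> 2|W - A|
    below.\<close>
  obtain N where N: "\<And>n. \<exists>A. A \<subseteq> pverts (G n) \<and> A \<noteq> {} \<and>
      finite (nbhd X 1 A) \<and> card (nbhd X 1 A) \<le> N \<and>
      real (card (bdry X 1 A \<inter> pverts (G n))) < 1/2 * real (card A)"
    using ULA_bounded_sets[OF X \<open>ULA X\<close>, of "1/2"] half_gt_zero[OF zero_less_one] by blast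
  have "\<forall>\<^sub>F n in sequentially. enat N < girth (G n)"
    using assms(2) unfolding large_girth_def by (rule order_tendstoD) simp
  then obtain n where n: "enat N < girth (G n)"
    using eventually_happens'[OF sequentially_bot] by blast
  obtain A where A: "A \<subseteq> pverts (G n)" "A \<noteq> {}" "finite (nbhd X 1 A)" "card (nbhd X 1 A) \<le> N"
      "real (card (bdry X 1 A \<inter> pverts (G n))) < 1/2 * real (card A)"
    using N[of n] by blast
  interpret pair_graph "G n"
    using X by (simp add: space_of_graphs_def)
  have sub: "pverts (G n) \<subseteq> X" using X by (auto simp: space_of_graphs_def)
  \<comment> \<open>Intersecting with the graph makes \<open>W - A\<close> exactly the part of the
    boundary controlled by the choice of \<open>A\<close>.\<close>
  define W where "W = nbhd X 1 A \<inter> pverts (G n)"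
  have "A \<subseteq> W"
    using subset_nbhd[of A X 1] A(1) sub by (auto simp: W_def)
  moreover have "v \<in> W" if "u \<in> A" "(u, v) \<in> parcs (G n)" for u v
  proof -
    have "infdist v A \<le> 1"
      using infdist_le2[OF that(1), of v 1] dist_le_one_if_arc[OF X that(2)]
      by (simp add: dist_commute)
    moreover have "v \<in> pverts (G n)" using that(2) by (auto dest: wellformed)
    ultimately show ?thesis using sub A(2) by (auto simp: W_def nbhd_def)
  qed
  moreover have "card W \<le> N"
    using A(3,4) card_mono[of "nbhd X 1 A" W] by (auto simp: W_def)
  then have "enat (card W) < girth (G n)"
    using n by (meson enat_ord_simps(1) le_less_trans)
  ultimately have "card A \<le> 2 * card (W - A)"
    using A(1) deg by (intro card_le_two_boundary_if_girth_gt[OF pair_graph]) (auto simp: W_def)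
  moreover have "W - A = bdry X 1 A \<inter> pverts (G n)"
    by (auto simp: W_def bdry_def)
  ultimately show False using A(5) by simp
qed

theorem theorem4p2:
  fixes X :: "'a::metric_space set"
    and G :: "nat \<Rightarrow> 'a pair_pre_digraph"
  assumes "space_of_graphs X G"
    and "expander X G \<or>
         (large_girth G \<and> (\<forall>n. \<forall>v\<in>pverts (G n). out_degree (with_proj (G n)) v \<ge> 3))"
  shows "\<not> ULA X"
  using assms expander_not_ULA large_girth_not_ULA by blast

end
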